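(* Let $1\le p<\infty$ and let $\mu$ be a finite Borel measure on $\mathbb{R}^n$ (not identically zero) with a radially decreasing density. Let $R>r>0$ be two positive radii, let $\xi\in\mathbb{R}^n$ be a unit vector, and write $\tilde B=B(R\xi,R+r)$. Then $$C_{\mu,p}\ \ge\ \frac{\mu(B_R)}{\mu(\tilde B)}\left(\frac{\mu(B_r)}{\mu(B_R)}\right)^{\frac{p-1}{p}} .$$
   Context: All balls are Euclidean: $B(x,R)$ is the ball in $\mathbb{R}^n$ of center $x$ and radius $R$, and $B_R=B(0,R)$. For a Borel measure $\mu$ on $\mathbb{R}^n$ and $g\in L^1_{loc}(\mathbb{R}^n)$ (with respect to $\mu$), the centered maximal function is $$M_\mu g(x)=\sup_{R>0}\frac{1}{\mu(B(x,R))}\int_{B(x,R)}|g(y)|\,d\mu(y)$$ (considered for $x$ in the support of $\mu$). $C_{\mu,p}\in[0,\infty]$ denotes the best (smallest) constant $C$ such that $\|M_\mu g\|_{L^p(\mu)}\le C\|g\|_{L^p(\mu)}$ for all $g\in L^p(\mu)$, with $C_{\mu,p}=\infty$ if there is no such finite constant. A measure $\mu$ has a radially decreasing density if $d\mu(x)=f(|x|)\,dx$ with $f:[0,\infty)\to[0,\infty)$ decreasing (non-increasing). *)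

theory Defs
  imports "HOL-Analysis.Analysis"
begin

text \<open>Real powers on \<open>[0,\<infinity>]\<close>, meant for exponents \<open>a > 0\<close>; there \<open>0\<close> is sent to \<open>0\<close>
  and \<open>\<infinity>\<close> to \<open>\<infinity>\<close>.\<close>

definition ennpowr :: "ennreal \<Rightarrow> real \<Rightarrow> ennreal" where
  "ennpowr x a = (if x = top then top else ennreal (enn2real x powr a))"

text \<open>The norm is defined for functions with values in \<open>[0,\<infinity>]\<close>, since maximal functions may be
  infinite; a real function \<open>g\<close> enters through \<open>\<lambda>x. ennreal \<bar>g x\<bar>\<close>.\<close>

definition Lp_norm :: "real \<Rightarrow> 'a measure \<Rightarrow> ('a \<Rightarrow> ennreal) \<Rightarrow> ennreal" where
  "Lp_norm p \<mu> h = ennpowr (\<integral>\<^sup>+ x. ennpowr (h x) p \<partial>\<mu>) (1 / p)"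

definition Lp :: "real \<Rightarrow> 'a measure \<Rightarrow> ('a \<Rightarrow> real) set" where
  "Lp p \<mu> = {g \<in> borel_measurable \<mu>. Lp_norm p \<mu> (\<lambda>x. ennreal \<bar>g x\<bar>) < top}"

text \<open>Balls are open. If \<open>x\<close> lies in the support of \<open>\<mu>\<close>, every denominator is positive. The
  complement of the support is a \<open>\<mu>\<close>-null set, so the value there (with \<open>0 / 0 = 0\<close> in
  \<^typ>\<open>ennreal\<close>) does not affect any \<open>L\<^sup>p(\<mu>)\<close> norm.\<close>

definition maximal_function ::
  "'a::euclidean_space measure \<Rightarrow> ('a \<Rightarrow> real) \<Rightarrow> 'a \<Rightarrow> ennreal" where
  "maximal_function \<mu> g x =
     (SUP R\<in>{0<..}. (\<integral>\<^sup>+ y\<in>ball x R. ennreal \<bar>g y\<bar> \<partial>\<mu>) / emeasure \<mu> (ball x R))"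

text \<open>The infimum over finite constants; it is \<open>\<infinity>\<close> if there is none, as \<open>Inf {} = top\<close>.\<close>

definition maximal_constant :: "'a::euclidean_space measure \<Rightarrow> real \<Rightarrow> ennreal" where
  "maximal_constant \<mu> p =
     Inf {C. C < top \<and> (\<forall>g\<in>Lp p \<mu>. Lp_norm p \<mu> (maximal_function \<mu> g)
                                  \<le> C * Lp_norm p \<mu> (\<lambda>x. ennreal \<bar>g x\<bar>))}"

definition radially_decreasing_density :: "'a::euclidean_space measure \<Rightarrow> bool" where
  "radially_decreasing_density \<mu> \<longleftrightarrow>
     (\<exists>f :: real \<Rightarrow> real. (\<forall>t\<ge>0. 0 \<le> f t) \<and> antimono_on {0..} f \<and>
        \<mu> = density lborel (\<lambda>x. ennreal (f (norm x))))"

end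

theory Submission
  imports Defs
begin

text \<open>
  Test the maximal inequality on the indicator \<open>g\<close> of \<open>B\<^sub>r\<close>. If \<open>norm x \<le> R\<close>, then
  \<open>B(x, norm x + r)\<close> contains \<open>B\<^sub>r\<close>, and a rotation taking \<open>x\<close> to \<open>norm x *\<^sub>R \<xi>\<close> moves it
  into \<open>B(R\<xi>, R + r)\<close>. Since \<open>\<mu>\<close> is rotation invariant, the maximal function of \<open>g\<close> is
  at least \<open>\<mu>(B\<^sub>r) / \<mu>(B(R\<xi>, R + r))\<close> throughout \<open>B\<^sub>R\<close>, and one compares norms.
\<close>

text \<open>The library's measure-invariance results for linear maps on \<^typ>\<open>real ^ 'n\<close> require a
  well-ordered index type. The Fubini argument for uniqueness of Haar measure avoids this: for
  \<open>\<nu>\<close> the image of Lebesgue measure, integrate \<open>indicator A x * indicator B (x + y)\<close> in both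
  orders, with \<open>A\<close> the unit ball, which \<open>T\<close> preserves.\<close>

lemma lborel_distr_orthogonal:
  fixes T :: "'a::euclidean_space \<Rightarrow> 'a"
  assumes T: "orthogonal_transformation T"
  shows "distr lborel borel T = lborel"
proof -
  have linT: "linear T"
    using T by (rule orthogonal_transformation_linear)
  have [measurable]: "T \<in> borel_measurable borel"
    using linT by (intro borel_measurable_continuous_onI linear_continuous_on)
      (simp add: linear_conv_bounded_linear)
  define \<nu> where "\<nu> = distr lborel borel T"
  have sets_\<nu>[measurable_cong, simp]: "sets \<nu> = sets borel"
    and space_\<nu>[simp]: "space \<nu> = UNIV"
    by (simp_all add: \<nu>_def)
  have trans_lborel: "(\<integral>\<^sup>+ x. h (a + x) \<partial>lborel) = (\<integral>\<^sup>+ x. h x \<partial>lborel)"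
    if [measurable]: "h \<in> borel_measurable borel" for h :: "'a \<Rightarrow> ennreal" and a
  proof -
    have "(\<integral>\<^sup>+ x. h x \<partial>lborel) = (\<integral>\<^sup>+ x. h x \<partial>distr lborel borel ((+) a))"
      by (simp add: lborel_distr_plus)
    also have "\<dots> = (\<integral>\<^sup>+ x. h (a + x) \<partial>lborel)"
      by (rule nn_integral_distr) auto
    finally show ?thesis by simp
  qed
  \<comment> \<open>Surjectivity of \<open>T\<close> writes every shift as \<open>T b\<close>, and
    linearity moves it inside \<open>T\<close>, where it becomes a shift of Lebesgue
    measure.\<close>
  have trans_\<nu>: "(\<integral>\<^sup>+ x. h (a + x) \<partial>\<nu>) = (\<integral>\<^sup>+ x. h x \<partial>\<nu>)"
    if [measurable]: "h \<in> borel_measurable borel" for h :: "'a \<Rightarrow> ennreal" and a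
  proof -
    obtain b where b: "a = T b"
      using orthogonal_transformation_surj[OF T] by (metis surjD)
    have "(\<integral>\<^sup>+ x. h (a + x) \<partial>\<nu>) = (\<integral>\<^sup>+ x. h (T (b + x)) \<partial>lborel)"
      unfolding \<nu>_def b by (subst nn_integral_distr) (auto simp: linear_add[OF linT])
    also have "\<dots> = (\<integral>\<^sup>+ x. h (T x) \<partial>lborel)"
      by (rule trans_lborel) simp
    also have "\<dots> = (\<integral>\<^sup>+ x. h x \<partial>\<nu>)"
      unfolding \<nu>_def by (subst nn_integral_distr) auto
    finally show ?thesis .
  qed
  define A where "A = ball (0::'a) 1"
  have [measurable]: "A \<in> sets borel"
    by (simp add: A_def)
  have vimage_ball: "T -` ball 0 s = ball 0 s" for s
    using orthogonal_transformation_norm[OF T] by auto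
  have \<nu>_ball: "emeasure \<nu> (ball 0 s) = emeasure lborel (ball (0::'a) s)" for s
    unfolding \<nu>_def by (subst emeasure_distr) (auto simp: vimage_ball)
  have ball_finite: "emeasure lborel (ball (0::'a) s) \<noteq> top" for s
    using emeasure_lborel_ball_finite[of "0::'a" s] by auto
  \<comment> \<open>Fubini needs sigma-finiteness. Centered balls exhaust the space and have finite
    measure, since both measures agree on them.\<close>
  interpret \<nu>: sigma_finite_measure \<nu>
  proof
    have "(\<Union>i. ball (0::'a) (real i)) = UNIV"
      using reals_Archimedean2 by fastforce
    then show "\<exists>A. countable A \<and> A \<subseteq> sets \<nu> \<and> \<Union>A = space \<nu> \<and> (\<forall>a\<in>A. emeasure \<nu> a \<noteq> \<infinity>)"
      by (intro exI[of _ "range (\<lambda>i. ball 0 (real i))"])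
         (auto simp: \<nu>_ball ball_finite)
  qed
  interpret pair_sigma_finite lborel \<nu> ..
  have "emeasure \<nu> B = emeasure lborel B" if [measurable]: "B \<in> sets borel" for B
  proof -
    have "emeasure lborel A * emeasure \<nu> B
        = (\<integral>\<^sup>+ x. indicator A x * (\<integral>\<^sup>+ y. indicator B y \<partial>\<nu>) \<partial>lborel)"
      by (subst nn_integral_multc) auto
    also have "\<dots> = (\<integral>\<^sup>+ x. indicator A x * (\<integral>\<^sup>+ y. indicator B (x + y) \<partial>\<nu>) \<partial>lborel)"
      by (subst trans_\<nu>) auto
    also have "\<dots> = (\<integral>\<^sup>+ x. (\<integral>\<^sup>+ y. indicator A x * indicator B (x + y) \<partial>\<nu>) \<partial>lborel)"
      by (subst nn_integral_cmult) auto
    also have "\<dots> = (\<integral>\<^sup>+ y. (\<integral>\<^sup>+ x. indicator A x * indicator B (x + y) \<partial>lborel) \<partial>\<nu>)"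
      by (rule Fubini'[symmetric]) measurable
    also have "\<dots> = (\<integral>\<^sup>+ y. (\<integral>\<^sup>+ z. indicator A (z - y) * indicator B z \<partial>lborel) \<partial>\<nu>)"
    proof (rule nn_integral_cong)
      fix y
      show "(\<integral>\<^sup>+ x. indicator A x * indicator B (x + y) \<partial>lborel)
          = (\<integral>\<^sup>+ z. indicator A (z - y) * indicator B z \<partial>lborel)"
        using trans_lborel[of "\<lambda>z. indicator A (z - y) * indicator B z" y]
        by (simp add: add.commute)
    qed
    also have "\<dots> = (\<integral>\<^sup>+ z. (\<integral>\<^sup>+ y. indicator A (z - y) * indicator B z \<partial>\<nu>) \<partial>lborel)"
      by (rule Fubini') measurable
    also have "\<dots> = (\<integral>\<^sup>+ z. (\<integral>\<^sup>+ y. indicator A (z - y) \<partial>\<nu>) * indicator B z \<partial>lborel)"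
      by (subst nn_integral_multc) auto
    also have "\<dots> = (\<integral>\<^sup>+ z. emeasure lborel A * indicator B z \<partial>lborel)"
    proof (rule nn_integral_cong)
      \<comment> \<open>The unit ball is symmetric, so the reflection \<open>z - y\<close> may be
        replaced by the translation \<open>- z + y\<close>. The inner integral is then the same for
        all \<open>z\<close>.\<close>
      fix z
      have "(\<integral>\<^sup>+ y. indicator A (z - y) \<partial>\<nu>) = (\<integral>\<^sup>+ y. indicator A (- z + y) \<partial>\<nu>)"
        by (intro nn_integral_cong) (simp add: A_def indicator_def norm_minus_commute)
      also have "\<dots> = (\<integral>\<^sup>+ y. indicator A y \<partial>\<nu>)"
        by (rule trans_\<nu>) simp
      finally show "(\<integral>\<^sup>+ y. indicator A (z - y) \<partial>\<nu>) * indicator B z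
          = emeasure lborel A * indicator B z"
        by (simp add: A_def \<nu>_ball)
    qed
    also have "\<dots> = emeasure lborel A * emeasure lborel B"
      by (simp add: nn_integral_cmult)
    finally have eq: "emeasure lborel A * emeasure \<nu> B = emeasure lborel A * emeasure lborel B" .
    \<comment> \<open>The common factor cancels in \<open>ennreal\<close> because it is neither 0
      nor infinite.\<close>
    have "emeasure lborel A \<noteq> 0"
      using content_ball_pos[of 1 "0::'a"] by (auto simp: A_def measure_def)
    then show ?thesis
      using eq ball_finite by (simp add: A_def ennreal_mult_cancel_left)
  qed
  then show ?thesis
    unfolding \<nu>_def[symmetric] by (intro measure_eqI) auto
qed

text \<open>The density depends only on the norm, which \<open>T\<close> preserves, so invariance
  passes from Lebesgue measure to \<mu>.\<close>

lemma radially_decreasing_density_vimage: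
  fixes T :: "'a::euclidean_space \<Rightarrow> 'a"
  assumes \<mu>: "radially_decreasing_density \<mu>" and T: "orthogonal_transformation T"
    and [measurable]: "S \<in> sets borel"
  shows "emeasure \<mu> (T -` S) = emeasure \<mu> S"
proof -
  obtain f where anti: "antimono_on {0..} f"
    and \<mu>_eq: "\<mu> = density lborel (\<lambda>x. ennreal (f (norm x)))"
    using \<mu> unfolding radially_decreasing_density_def by blast
  \<comment> \<open>Measurability of the density comes from monotonicity. As \<open>f\<close> is
    controlled only on the half-line, it is first extended by the constant \<open>f 0\<close>; the
    extension agrees with \<open>f\<close> at every norm.\<close>
  have "mono (\<lambda>t. - f (max 0 t))"
    using anti by (auto simp: mono_def monotone_on_def)
  then have "(\<lambda>t. - (- f (max 0 t))) \<in> borel_measurable borel"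
    by (intro borel_measurable_uminus borel_measurable_mono)
  then have f_meas: "(\<lambda>t. f (max 0 t)) \<in> borel_measurable borel"
    by simp
  have "(\<lambda>x::'a. f (max 0 (norm x))) \<in> borel_measurable borel"
    by (rule measurable_compose[OF _ f_meas]) measurable
  then have [measurable]: "(\<lambda>x::'a. f (norm x)) \<in> borel_measurable borel"
    by simp
  have [measurable]: "T \<in> borel_measurable borel"
    using orthogonal_transformation_linear[OF T]
    by (intro borel_measurable_continuous_onI linear_continuous_on)
      (simp add: linear_conv_bounded_linear)
  have [measurable]: "T -` S \<in> sets borel"
    using measurable_sets[of T borel borel S] by simp
  have "emeasure \<mu> S = (\<integral>\<^sup>+ x. ennreal (f (norm x)) * indicator S x \<partial>lborel)"
    unfolding \<mu>_eq by (rule emeasure_density) auto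
  also have "\<dots> = (\<integral>\<^sup>+ x. ennreal (f (norm x)) * indicator S x \<partial>distr lborel borel T)"
    by (simp add: lborel_distr_orthogonal[OF T])
  also have "\<dots> = (\<integral>\<^sup>+ x. ennreal (f (norm (T x))) * indicator S (T x) \<partial>lborel)"
    by (rule nn_integral_distr) auto
  also have "\<dots> = (\<integral>\<^sup>+ x. ennreal (f (norm x)) * indicator (T -` S) x \<partial>lborel)"
    by (simp add: orthogonal_transformation_norm[OF T] indicator_def)
  also have "\<dots> = emeasure \<mu> (T -` S)"
    unfolding \<mu>_eq by (rule emeasure_density[symmetric]) auto
  finally show ?thesis by simp
qed

text \<open>Orthogonal maps act transitively on each sphere about the origin, and one taking
  \<open>x\<close> to \<open>y\<close> pulls \<open>ball y s\<close> back to
  \<open>ball x s\<close>.\<close>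

lemma emeasure_ball_rotate:
  fixes x y :: "real ^ 'n"
  assumes "radially_decreasing_density \<mu>" and "norm x = norm y"
  shows "emeasure \<mu> (ball x s) = emeasure \<mu> (ball y s)"
proof -
  obtain T where T: "orthogonal_transformation T" "T x = y"
    using orthogonal_transformation_exists[OF assms(2)] by blast
  have "T -` ball y s = ball x s"
  proof -
    have "T -` (T ` ball x s) = ball x s"
      by (rule inj_vimage_image_eq) (rule orthogonal_transformation_inj[OF T(1)])
    then show ?thesis
      using T by (simp add: image_orthogonal_transformation_ball)
  qed
  then show ?thesis
    using radially_decreasing_density_vimage[OF assms(1) T(1), of "ball y s"] by simp
qed

lemma ennpowr_mono:
  assumes "x \<le> y" and "0 < a"
  shows "ennpowr x a \<le> ennpowr y a"
  using assms
  by (auto simp: ennpowr_def top_unique less_top intro!: ennreal_leI powr_mono2 enn2real_mono)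

text \<open>Monotonicity of the nonnegative integral covers arbitrary functions, so this applies
  directly to maximal functions.\<close>

lemma Lp_norm_mono:
  assumes "0 < p" and "\<And>x. h x \<le> k x"
  shows "Lp_norm p \<mu> h \<le> Lp_norm p \<mu> k"
  unfolding Lp_norm_def using assms by (intro ennpowr_mono nn_integral_mono) auto

text \<open>Serves twice: with \<open>c = 1\<close> for the norm of the test function, and with
  \<open>c = a / t\<close> for the lower bound on its maximal function.\<close>

lemma Lp_norm_cmult_indicator:
  assumes p: "0 < p" and c: "0 \<le> c" and "finite_measure \<mu>" and A: "A \<in> sets \<mu>"
  shows "Lp_norm p \<mu> (\<lambda>x. ennreal c * indicator A x)
    = ennreal (c * measure \<mu> A powr (1 / p))"
proof -
  interpret finite_measure \<mu> by fact
  have "ennpowr (ennreal c * indicator A x) p = ennreal (c powr p) * indicator A x" for x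
    using c by (simp add: ennpowr_def split: split_indicator)
  then have "Lp_norm p \<mu> (\<lambda>x. ennreal c * indicator A x)
      = ennpowr (ennreal (c powr p * measure \<mu> A)) (1 / p)"
    using A by (simp add: Lp_norm_def nn_integral_cmult_indicator emeasure_eq_measure ennreal_mult')
  also have "\<dots> = ennreal (c * measure \<mu> A powr (1 / p))"
    using p c by (simp add: ennpowr_def powr_mult powr_powr)
  finally show ?thesis .
qed

text \<open>The supremum dominates its term at radius \<open>s\<close>, whose ball captures all the
  mass of \<open>A\<close>.\<close>

lemma maximal_function_indicator_ge:
  fixes A :: "'a::euclidean_space set"
  assumes "sets \<mu> = sets borel" and "A \<in> sets borel" and "A \<subseteq> ball x s" and "0 < s"
  shows "emeasure \<mu> A / emeasure \<mu> (ball x s) \<le> maximal_function \<mu> (indicator A) x"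
proof -
  have "(\<integral>\<^sup>+ y\<in>ball x s. ennreal \<bar>indicator A y\<bar> \<partial>\<mu>) = (\<integral>\<^sup>+ y. indicator A y \<partial>\<mu>)"
    using assms(3) by (intro nn_integral_cong) (auto split: split_indicator)
  also have "\<dots> = emeasure \<mu> A"
    using assms by simp
  finally show ?thesis
    unfolding maximal_function_def using assms(4) by (intro SUP_upper2[of s]) auto
qed

theorem proposition1p2:
  fixes \<mu> :: "(real ^ 'n) measure"
    and p r R :: real
    and \<xi> :: "real ^ 'n"
  assumes "1 \<le> p"
    and "sets \<mu> = sets borel"
    and "finite_measure \<mu>"
    and "emeasure \<mu> UNIV \<noteq> 0"
    and "radially_decreasing_density \<mu>"
    and "0 < r" and "r < R"
    and "norm \<xi> = 1"
  shows "maximal_constant \<mu> p \<ge>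
    ennreal (measure \<mu> (ball 0 R) / measure \<mu> (ball (R *\<^sub>R \<xi>) (R + r)) *
      (measure \<mu> (ball 0 r) / measure \<mu> (ball 0 R)) powr ((p - 1) / p))"
proof -
  interpret finite_measure \<mu> by fact
  note sets_\<mu>[simp] = assms(2)
  define a b t where "a = measure \<mu> (ball 0 r)" and "b = measure \<mu> (ball 0 R)"
    and "t = measure \<mu> (ball (R *\<^sub>R \<xi>) (R + r))"
  have p: "0 < p"
    using assms(1) by simp
  show ?thesis
  \<comment> \<open>Since \<open>0 powr q = 0\<close> for every \<open>q\<close>, even for
    \<open>q = 0\<close> at \<open>p = 1\<close>, the claimed bound is 0 when \<open>a = 0\<close>.
    Otherwise \<open>a\<close>, \<open>b\<close> and \<open>t\<close> are all positive and the
    quotients are genuine.\<close>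
  proof (cases "a = 0")
    case True
    then show ?thesis by (simp add: a_def)
  next
    case False
    then have a: "0 < a"
      by (simp add: a_def zero_less_measure_iff)
    have "a \<le> b"
      unfolding a_def b_def using assms by (intro finite_measure_mono subset_ball) auto
    with a have b: "0 < b" by simp
    have sub: "ball 0 r \<subseteq> ball x (norm x + r)" for x :: "real ^ 'n"
      by (simp add: ball_subset_ball_iff dist_norm)
    have "a \<le> t"
      unfolding a_def t_def using sub[of "R *\<^sub>R \<xi>"] assms by (intro finite_measure_mono) auto
    with a have t: "0 < t" by simp
    have max_ge: "ennreal (a / t) * indicator (ball 0 R) x
        \<le> maximal_function \<mu> (indicator (ball 0 r)) x" for x
    proof (cases "x \<in> ball 0 R")
      case True
      then have x: "norm x < R" by simp
      \<comment> \<open>The centers lie on one ray at distance \<open>R - norm x\<close>, exactly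
        the difference of the radii.\<close>
      have "ball (norm x *\<^sub>R \<xi>) (norm x + r) \<subseteq> ball (R *\<^sub>R \<xi>) (R + r)"
        using x assms by (simp add: ball_subset_ball_iff dist_norm flip: scaleR_diff_left)
      then have "measure \<mu> (ball (norm x *\<^sub>R \<xi>) (norm x + r)) \<le> t"
        unfolding t_def by (intro finite_measure_mono) auto
      then have le: "measure \<mu> (ball x (norm x + r)) \<le> t"
        using emeasure_ball_rotate[OF assms(5), of x "norm x *\<^sub>R \<xi>"] assms(8)
        by (simp add: measure_def)
      \<comment> \<open>This makes the denominator of the average positive, so that the
        \<open>ennreal\<close> quotient is a real one.\<close>
      have "a \<le> measure \<mu> (ball x (norm x + r))"
        unfolding a_def using sub by (intro finite_measure_mono) auto
      then have "ennreal (a / t) \<le> emeasure \<mu> (ball 0 r) / emeasure \<mu> (ball x (norm x + r))"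
        using le a by (simp add: a_def emeasure_eq_measure divide_ennreal frac_le ennreal_leI)
      also have "\<dots> \<le> maximal_function \<mu> (indicator (ball 0 r)) x"
        using assms(6) sub by (intro maximal_function_indicator_ge) (auto simp: add_nonneg_pos)
      finally show ?thesis using True by simp
    qed simp
    have norm_g: "Lp_norm p \<mu> (\<lambda>x. ennreal \<bar>indicator (ball 0 r) x\<bar>) = ennreal (a powr (1 / p))"
      using Lp_norm_cmult_indicator[of p 1 \<mu> "ball 0 r"] p assms(3)
      by (simp add: a_def ennreal_indicator)
    then have g: "indicator (ball 0 r) \<in> Lp p \<mu>"
      by (simp add: Lp_def borel_measurable_indicator)
    have "ennreal (b / t * (a / b) powr ((p - 1) / p)) \<le> C"
      if "C < top" and C: "\<forall>g\<in>Lp p \<mu>. Lp_norm p \<mu> (maximal_function \<mu> g)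
        \<le> C * Lp_norm p \<mu> (\<lambda>x. ennreal \<bar>g x\<bar>)" for C
    proof -
      obtain c where c: "0 \<le> c" "C = ennreal c"
        using \<open>C < top\<close> by (cases C) auto
      \<comment> \<open>Testing \<open>C\<close> on the indicator gives
        \<open>a / t * b powr (1 / p) \<le> c * a powr (1 / p)\<close>; dividing by the last power
        isolates \<open>c\<close>.\<close>
      have "ennreal (a / t * b powr (1 / p))
          = Lp_norm p \<mu> (\<lambda>x. ennreal (a / t) * indicator (ball 0 R) x)"
        using a t p assms(3) by (subst Lp_norm_cmult_indicator) (auto simp: b_def)
      also have "\<dots> \<le> Lp_norm p \<mu> (maximal_function \<mu> (indicator (ball 0 r)))"
        using p max_ge by (rule Lp_norm_mono)
      also have "\<dots> \<le> C * ennreal (a powr (1 / p))"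
        using bspec[OF C g] by (simp only: norm_g)
      also have "\<dots> = ennreal (c * a powr (1 / p))"
        using c by (simp add: ennreal_mult)
      finally have "a / t * b powr (1 / p) \<le> c * a powr (1 / p)"
        using c by (simp add: ennreal_le_iff)
      then have "a / t * b powr (1 / p) / a powr (1 / p) \<le> c"
        using a by (simp only: pos_divide_le_eq powr_gt_zero)
      \<comment> \<open>As \<open>(p - 1) / p = 1 - 1 / p\<close>, one full factor
        \<open>a / b\<close> splits off and turns \<open>b / t\<close> into
        \<open>a / t\<close>.\<close>
      moreover have "b / t * (a / b) powr ((p - 1) / p) = a / t * b powr (1 / p) / a powr (1 / p)"
      proof -
        have "(a / b) powr ((p - 1) / p) = (a / b) powr (1 - 1 / p)"
          using p by (simp add: diff_divide_distrib)
        also have "\<dots> = (a / b) / (a powr (1 / p) / b powr (1 / p))"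
          using a b by (simp add: powr_diff powr_divide)
        finally show ?thesis
          using a b t by (simp add: field_simps)
      qed
      ultimately show ?thesis
        using c by (simp add: ennreal_leI)
    qed
    then show ?thesis
      unfolding maximal_constant_def a_def b_def t_def by (intro Inf_greatest) auto
  qed
qed

end
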